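(* The smallest F-epimorphically closed pseudovariety of semigroups containing the semigroup $Y$ is the pseudovariety of all finite semigroups.
   Context: A pseudovariety of semigroups is a class of finite semigroups closed under taking homomorphic images, subsemigroups, and finite direct products. A homomorphism of semigroups $\alpha:S\to T$ is an epimorphism if, for all semigroups $R$ and homomorphisms $\beta,\gamma:T\to R$, $\beta\circ\alpha=\gamma\circ\alpha$ implies $\beta=\gamma$. A class $\mathcal{C}$ of finite semigroups is F-epimorphically closed if, for every epimorphism $S\to T$ with $T$ a finite semigroup, if $S\in\mathcal{C}$ then $T\in\mathcal{C}$. $B_2=\langle a,b: aba=a,\ bab=b,\ a^2=b^2=0\rangle$ is the five-element aperiodic Brandt semigroup (with zero $0$), and $Y=\{ab,a,ba,0\}=B_2\setminus\{b\}$, a subsemigroup of $B_2$. *)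

theory Defs
  imports Main "HOL-Library.FuncSet" "HOL-Library.Countable_Set" "HOL-Algebra.Congruence"
begin

record 'a sgrp = "'a partial_object" +
  mult :: "'a \<Rightarrow> 'a \<Rightarrow> 'a" (infixl "\<cdot>\<index>" 70)

text \<open>Semigroups are nonempty, as is customary for pseudovarieties.\<close>

definition is_semigroup :: "'a sgrp \<Rightarrow> bool" where
  "is_semigroup S \<longleftrightarrow> carrier S \<noteq> {}
     \<and> (\<forall>x\<in>carrier S. \<forall>y\<in>carrier S. x \<cdot>\<^bsub>S\<^esub> y \<in> carrier S)
     \<and> (\<forall>x\<in>carrier S. \<forall>y\<in>carrier S. \<forall>z\<in>carrier S.
          (x \<cdot>\<^bsub>S\<^esub> y) \<cdot>\<^bsub>S\<^esub> z = x \<cdot>\<^bsub>S\<^esub> (y \<cdot>\<^bsub>S\<^esub> z))"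

definition is_subsemigroup :: "'a set \<Rightarrow> 'a sgrp \<Rightarrow> bool" where
  "is_subsemigroup H S \<longleftrightarrow> H \<noteq> {} \<and> H \<subseteq> carrier S \<and> (\<forall>x\<in>H. \<forall>y\<in>H. x \<cdot>\<^bsub>S\<^esub> y \<in> H)"

definition sgrp_hom :: "'a sgrp \<Rightarrow> 'b sgrp \<Rightarrow> ('a \<Rightarrow> 'b) set" where
  "sgrp_hom S T = {f \<in> carrier S \<rightarrow> carrier T.
     \<forall>x\<in>carrier S. \<forall>y\<in>carrier S. f (x \<cdot>\<^bsub>S\<^esub> y) = f x \<cdot>\<^bsub>T\<^esub> f y}"

definition sgrp_iso :: "'a sgrp \<Rightarrow> 'b sgrp \<Rightarrow> bool" where
  "sgrp_iso S T \<longleftrightarrow> (\<exists>f\<in>sgrp_hom S T. bij_betw f (carrier S) (carrier T))"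

definition sgrp_prod :: "nat \<Rightarrow> (nat \<Rightarrow> 'a sgrp) \<Rightarrow> (nat \<Rightarrow> 'a) sgrp" where
  "sgrp_prod n S = \<lparr>carrier = (\<Pi>\<^sub>E i\<in>{..<n}. carrier (S i)),
     mult = (\<lambda>x y. \<lambda>i\<in>{..<n}. x i \<cdot>\<^bsub>S i\<^esub> y i)\<rparr>"

text \<open>
  The test semigroups R range over semigroups, finite or infinite, with carrier in the naturals.
  When T is countable, in particular finite, this is the same as letting R range over all
  semigroups whatsoever: see lemma epimorphism_cancel below.
\<close>

definition epimorphism :: "'a sgrp \<Rightarrow> 'b sgrp \<Rightarrow> ('a \<Rightarrow> 'b) \<Rightarrow> bool" where
  "epimorphism S T \<alpha> \<longleftrightarrow> is_semigroup S \<and> is_semigroup T \<and> \<alpha> \<in> sgrp_hom S T \<and>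
     (\<forall>R :: nat sgrp. is_semigroup R \<longrightarrow>
        (\<forall>\<beta>\<in>sgrp_hom T R. \<forall>\<gamma>\<in>sgrp_hom T R.
           (\<forall>x\<in>carrier S. \<beta> (\<alpha> x) = \<gamma> (\<alpha> x)) \<longrightarrow> (\<forall>y\<in>carrier T. \<beta> y = \<gamma> y)))"

text \<open>
  Classes of finite semigroups are represented by sets of semigroups whose carrier is a finite
  set of naturals; every finite semigroup has such a copy (lemma finite_semigroup_has_copy), and a
  semigroup over an arbitrary type belongs to a class if a copy of it does.
\<close>

definition finite_semigroups :: "nat sgrp set" where
  "finite_semigroups = {S. is_semigroup S \<and> finite (carrier S)}"

definition contains_copy :: "nat sgrp set \<Rightarrow> 'a sgrp \<Rightarrow> bool" where
  "contains_copy C T \<longleftrightarrow> (\<exists>S\<in>C. sgrp_iso S T)"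

definition pseudovariety :: "nat sgrp set \<Rightarrow> bool" where
  "pseudovariety C \<longleftrightarrow> C \<subseteq> finite_semigroups
     \<and> (\<forall>S\<in>C. \<forall>T\<in>finite_semigroups. \<forall>f\<in>sgrp_hom S T. f ` carrier S = carrier T \<longrightarrow> T \<in> C)
     \<and> (\<forall>S\<in>C. \<forall>H. is_subsemigroup H S \<longrightarrow> \<lparr>carrier = H, mult = mult S\<rparr> \<in> C)
     \<and> (\<forall>n S. (\<forall>i<n. S i \<in> C) \<longrightarrow> contains_copy C (sgrp_prod n S))"

definition F_epimorphically_closed :: "nat sgrp set \<Rightarrow> bool" where
  "F_epimorphically_closed C \<longleftrightarrow>
     (\<forall>S\<in>C. \<forall>T\<in>finite_semigroups. \<forall>\<alpha>. epimorphism S T \<alpha> \<longrightarrow> T \<in> C)"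

datatype b2 = Zero | A | B | AB | BA

text \<open>Multiplication in normal form; lemma b2_presentation below shows that this is the semigroup
  with zero presented by aba = a, bab = b, aa = bb = 0.\<close>

fun b2_mult :: "b2 \<Rightarrow> b2 \<Rightarrow> b2" where
  "b2_mult A B = AB"
| "b2_mult B A = BA"
| "b2_mult AB A = A"
| "b2_mult AB AB = AB"
| "b2_mult A BA = A"
| "b2_mult BA B = B"
| "b2_mult BA BA = BA"
| "b2_mult B AB = B"
| "b2_mult _ _ = Zero"

definition B2 :: "b2 sgrp" where
  "B2 = \<lparr>carrier = UNIV, mult = b2_mult\<rparr>"

definition Y :: "b2 sgrp" where
  "Y = \<lparr>carrier = {AB, A, BA, Zero}, mult = b2_mult\<rparr>"


subsection \<open>Adequacy of the encoding\<close>

definition transport :: "('a \<Rightarrow> 'b) \<Rightarrow> 'a sgrp \<Rightarrow> 'b sgrp" where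
  "transport h S = \<lparr>carrier = h ` carrier S,
     mult = (\<lambda>i j. h (inv_into (carrier S) h i \<cdot>\<^bsub>S\<^esub> inv_into (carrier S) h j))\<rparr>"

lemma transport:
  assumes S: "is_semigroup S" and h: "inj_on h (carrier S)"
  shows "is_semigroup (transport h S)" "h \<in> sgrp_hom S (transport h S)"
    "inv_into (carrier S) h \<in> sgrp_hom (transport h S) S"
  using assms by (auto simp: is_semigroup_def transport_def sgrp_hom_def)

lemma finite_semigroup_has_copy:
  assumes "is_semigroup S" "finite (carrier S)"
  shows "contains_copy finite_semigroups S"
proof -
  obtain h :: "'a \<Rightarrow> nat" where h: "inj_on h (carrier S)"
    using assms(2) by (meson finite_imp_inj_to_nat_seg)
  have "transport h S \<in> finite_semigroups"
    using transport(1)[OF assms(1) h] assms(2)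
    by (simp add: finite_semigroups_def transport_def)
  moreover have "bij_betw (inv_into (carrier S) h) (carrier (transport h S)) (carrier S)"
    using h by (simp add: transport_def inj_on_imp_bij_betw bij_betw_inv_into)
  ultimately show ?thesis
    using transport(3)[OF assms(1) h] unfolding contains_copy_def sgrp_iso_def by blast
qed

lemma epimorphism_cancel:
  fixes R :: "'r sgrp"
  assumes epi: "epimorphism S T \<alpha>" and T: "countable (carrier T)" and R: "is_semigroup R"
    and b: "\<beta> \<in> sgrp_hom T R" and c: "\<gamma> \<in> sgrp_hom T R"
    and eq: "\<forall>x\<in>carrier S. \<beta> (\<alpha> x) = \<gamma> (\<alpha> x)"
  shows "\<forall>y\<in>carrier T. \<beta> y = \<gamma> y"
proof -
  define X where "X = \<beta> ` carrier T \<union> \<gamma> ` carrier T"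
  define G where "G = {foldl (mult R) x xs |x xs. x \<in> X \<and> xs \<in> lists X}"
  have XR: "X \<subseteq> carrier R"
    using b c by (auto simp: X_def sgrp_hom_def)
  have cl: "\<And>x y. x \<in> carrier R \<Longrightarrow> y \<in> carrier R \<Longrightarrow> x \<cdot>\<^bsub>R\<^esub> y \<in> carrier R"
    and asc: "\<And>x y z. x \<in> carrier R \<Longrightarrow> y \<in> carrier R \<Longrightarrow> z \<in> carrier R \<Longrightarrow>
      (x \<cdot>\<^bsub>R\<^esub> y) \<cdot>\<^bsub>R\<^esub> z = x \<cdot>\<^bsub>R\<^esub> (y \<cdot>\<^bsub>R\<^esub> z)"
    using R by (auto simp: is_semigroup_def)
  have fc: "foldl (mult R) x xs \<in> carrier R" if "x \<in> carrier R" "set xs \<subseteq> carrier R" for x xs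
    using that by (induction xs arbitrary: x) (auto simp: cl)
  have fm: "u \<cdot>\<^bsub>R\<^esub> foldl (mult R) y ys = foldl (mult R) u (y # ys)"
    if "u \<in> carrier R" "y \<in> carrier R" "set ys \<subseteq> carrier R" for u y ys
    using that by (induction ys arbitrary: y) (auto simp: cl asc)
  have GR: "G \<subseteq> carrier R"
    using XR fc by (auto simp: G_def subset_iff)
  have XG: "X \<subseteq> G"
  proof
    fix x assume "x \<in> X"
    then have "x = foldl (mult R) x [] \<and> x \<in> X \<and> [] \<in> lists X" by simp
    then show "x \<in> G" unfolding G_def by blast
  qed
  have Gcl: "p \<cdot>\<^bsub>R\<^esub> q \<in> G" if pq: "p \<in> G" "q \<in> G" for p q
  proof -
    obtain x xs y ys where *: "x \<in> X" "xs \<in> lists X" "y \<in> X" "ys \<in> lists X"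
      "p = foldl (mult R) x xs" "q = foldl (mult R) y ys"
      using pq unfolding G_def by blast
    have "p \<cdot>\<^bsub>R\<^esub> q = foldl (mult R) p (y # ys)"
      unfolding *(6) using * XR GR pq(1) by (intro fm) auto
    also have "\<dots> = foldl (mult R) x (xs @ y # ys)"
      by (simp add: *)
    finally have "p \<cdot>\<^bsub>R\<^esub> q = foldl (mult R) x (xs @ y # ys)" .
    moreover have "xs @ y # ys \<in> lists X" using * by simp
    ultimately show ?thesis unfolding G_def using *(1) by blast
  qed
  have "G = (\<lambda>(x, xs). foldl (mult R) x xs) ` (X \<times> lists X)"
    unfolding G_def by (auto simp: image_def)
  moreover have "countable (X \<times> lists X)"
    using T by (simp add: X_def)
  ultimately have "countable G" by simp
  then have inj: "inj_on (to_nat_on G) G" by (rule inj_on_to_nat_on)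
  define R0 where "R0 = \<lparr>carrier = G, mult = mult R\<rparr>"
  have ne: "carrier T \<noteq> {}"
    using epi by (simp add: epimorphism_def is_semigroup_def)
  have R0: "is_semigroup R0"
    using ne XG Gcl GR asc by (auto simp: is_semigroup_def R0_def X_def subset_iff)
  have inj0: "inj_on (to_nat_on G) (carrier R0)"
    using inj by (simp add: R0_def)
  note tr = transport[OF R0 inj0]
  have hom: "to_nat_on G \<circ> f \<in> sgrp_hom T (transport (to_nat_on G) R0)"
    if "f \<in> sgrp_hom T R" "f ` carrier T \<subseteq> G" for f
    using tr(2) that unfolding sgrp_hom_def by (auto simp: R0_def Pi_iff image_subset_iff)
  have sub: "\<beta> ` carrier T \<subseteq> G" "\<gamma> ` carrier T \<subseteq> G"
    using XG by (auto simp: X_def)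
  have "\<forall>x\<in>carrier S. (to_nat_on G \<circ> \<beta>) (\<alpha> x) = (to_nat_on G \<circ> \<gamma>) (\<alpha> x)"
    using eq by simp
  then have "\<forall>y\<in>carrier T. (to_nat_on G \<circ> \<beta>) y = (to_nat_on G \<circ> \<gamma>) y"
    using epi tr(1) hom[OF b sub(1)] hom[OF c sub(2)] unfolding epimorphism_def by blast
  then show ?thesis
    using inj sub by (auto simp: inj_on_def image_subset_iff)
qed

lemma B2_is_semigroup: "is_semigroup B2"
proof -
  have "b2_mult (b2_mult x y) z = b2_mult x (b2_mult y z)" for x y z
    by (cases x; cases y; cases z) simp_all
  then show ?thesis by (simp add: is_semigroup_def B2_def)
qed

lemma Y_subsemigroup: "is_subsemigroup (carrier Y) B2" "carrier Y = carrier B2 - {B}"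
  by (auto simp: is_subsemigroup_def Y_def B2_def intro: b2.exhaust)

lemma b2_relations:
  "b2_mult (b2_mult A B) A = A" "b2_mult (b2_mult B A) B = B"
  "b2_mult A A = Zero" "b2_mult B B = Zero" "b2_mult Zero x = Zero" "b2_mult x Zero = Zero"
  "AB = b2_mult A B" "BA = b2_mult B A"
  by (cases x; simp)+

lemma b2_presentation:
  fixes R :: "'r sgrp"
  assumes R: "is_semigroup R" and c: "a \<in> carrier R" "b \<in> carrier R" "z \<in> carrier R"
    and z: "\<And>x. x \<in> carrier R \<Longrightarrow> z \<cdot>\<^bsub>R\<^esub> x = z" "\<And>x. x \<in> carrier R \<Longrightarrow> x \<cdot>\<^bsub>R\<^esub> z = z"
    and rel: "a \<cdot>\<^bsub>R\<^esub> b \<cdot>\<^bsub>R\<^esub> a = a" "b \<cdot>\<^bsub>R\<^esub> a \<cdot>\<^bsub>R\<^esub> b = b"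
      "a \<cdot>\<^bsub>R\<^esub> a = z" "b \<cdot>\<^bsub>R\<^esub> b = z"
  shows "\<exists>!f. f \<in> sgrp_hom B2 R \<and> f A = a \<and> f B = b \<and> f Zero = z"
proof -
  define f where "f x = (case x of Zero \<Rightarrow> z | A \<Rightarrow> a | B \<Rightarrow> b | AB \<Rightarrow> a \<cdot>\<^bsub>R\<^esub> b | BA \<Rightarrow> b \<cdot>\<^bsub>R\<^esub> a)" for x
  have cl: "\<And>x y. x \<in> carrier R \<Longrightarrow> y \<in> carrier R \<Longrightarrow> x \<cdot>\<^bsub>R\<^esub> y \<in> carrier R"
    and asc: "\<And>x y w. x \<in> carrier R \<Longrightarrow> y \<in> carrier R \<Longrightarrow> w \<in> carrier R \<Longrightarrow>
      (x \<cdot>\<^bsub>R\<^esub> y) \<cdot>\<^bsub>R\<^esub> w = x \<cdot>\<^bsub>R\<^esub> (y \<cdot>\<^bsub>R\<^esub> w)"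
    using R by (auto simp: is_semigroup_def)
  have rel': "a \<cdot>\<^bsub>R\<^esub> (b \<cdot>\<^bsub>R\<^esub> a) = a" "b \<cdot>\<^bsub>R\<^esub> (a \<cdot>\<^bsub>R\<^esub> b) = b"
    using rel asc c by simp_all
  have rel2: "a \<cdot>\<^bsub>R\<^esub> (a \<cdot>\<^bsub>R\<^esub> x) = z" "b \<cdot>\<^bsub>R\<^esub> (b \<cdot>\<^bsub>R\<^esub> x) = z"
    if "x \<in> carrier R" for x
    using that rel asc[of a a x] asc[of b b x] c z by simp_all
  have m: "f (b2_mult x y) = f x \<cdot>\<^bsub>R\<^esub> f y" for x y
    by (cases x; cases y) (simp_all add: f_def cl asc c z rel' rel2 rel(3,4))
  have fc: "f x \<in> carrier R" for x
    by (cases x) (simp_all add: f_def cl c)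
  show ?thesis
  proof (rule ex1I[of _ f])
    show "f \<in> sgrp_hom B2 R \<and> f A = a \<and> f B = b \<and> f Zero = z"
      using m fc by (simp add: sgrp_hom_def B2_def) (simp add: f_def)
  next
    fix g assume g: "g \<in> sgrp_hom B2 R \<and> g A = a \<and> g B = b \<and> g Zero = z"
    then have gm: "g (b2_mult x y) = g x \<cdot>\<^bsub>R\<^esub> g y" for x y
      by (simp add: sgrp_hom_def B2_def)
    have "g x = f x" for x
      using g gm[of A B] gm[of B A] by (cases x) (simp_all add: f_def)
    then show "g = f" by blast
  qed
qed

end

theory Submission
  imports Defs
begin

text \<open>
  For a monoid \<open>M\<close> with identity \<open>u\<close> consider the semigroup of 2 by 2 matrices with at most one
  nonzero entry, taken from \<open>M\<close>. Its triangular subsemigroup, formed by zero, the two diagonal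
  idempotents and all \<open>m e\<^sub>1\<^sub>2\<close>, embeds into a power of \<open>Y\<close>, because the products of the
  off-diagonal elements do not depend on \<open>M\<close>. The inclusion of the triangular subsemigroup is an
  epimorphism: \<open>u e\<^sub>2\<^sub>1\<close> is an inverse of \<open>u e\<^sub>1\<^sub>2\<close>, hence is determined by it and the two
  idempotents, and together they generate everything. Finally \<open>M\<close> embeds as \<open>M e\<^sub>1\<^sub>1\<close>. Every
  semigroup embeds into a monoid, so every finite semigroup is reached.
\<close>

section \<open>Homomorphisms, isomorphisms and finite products of semigroups\<close>

lemma is_semigroupD:
  assumes "is_semigroup S"
  shows "x \<in> carrier S \<Longrightarrow> y \<in> carrier S \<Longrightarrow> x \<cdot>\<^bsub>S\<^esub> y \<in> carrier S"
    and "x \<in> carrier S \<Longrightarrow> y \<in> carrier S \<Longrightarrow> z \<in> carrier S \<Longrightarrow>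
      (x \<cdot>\<^bsub>S\<^esub> y) \<cdot>\<^bsub>S\<^esub> z = x \<cdot>\<^bsub>S\<^esub> (y \<cdot>\<^bsub>S\<^esub> z)"
    and "carrier S \<noteq> {}"
  using assms by (auto simp: is_semigroup_def)

lemma sgrp_homD:
  assumes "f \<in> sgrp_hom S T"
  shows "x \<in> carrier S \<Longrightarrow> f x \<in> carrier T"
    and "x \<in> carrier S \<Longrightarrow> y \<in> carrier S \<Longrightarrow> f (x \<cdot>\<^bsub>S\<^esub> y) = f x \<cdot>\<^bsub>T\<^esub> f y"
  using assms by (auto simp: sgrp_hom_def)

lemma sgrp_homI:
  assumes "\<And>x. x \<in> carrier S \<Longrightarrow> f x \<in> carrier T"
    and "\<And>x y. x \<in> carrier S \<Longrightarrow> y \<in> carrier S \<Longrightarrow> f (x \<cdot>\<^bsub>S\<^esub> y) = f x \<cdot>\<^bsub>T\<^esub> f y"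
  shows "f \<in> sgrp_hom S T"
  using assms by (auto simp: sgrp_hom_def)

lemma sgrp_hom_comp:
  assumes "f \<in> sgrp_hom S T" "g \<in> sgrp_hom T U"
  shows "g \<circ> f \<in> sgrp_hom S U"
  using assms by (auto simp: sgrp_hom_def Pi_iff)

lemma sgrp_hom_inv_into:
  assumes S: "is_semigroup S" and f: "f \<in> sgrp_hom S T" "bij_betw f (carrier S) (carrier T)"
  shows "inv_into (carrier S) f \<in> sgrp_hom T S"
proof (rule sgrp_homI)
  let ?g = "inv_into (carrier S) f"
  have g: "?g x \<in> carrier S" "f (?g x) = x" if "x \<in> carrier T" for x
    using f(2) that by (auto simp: bij_betw_def intro: inv_into_into f_inv_into_f)
  show "?g x \<in> carrier S" if "x \<in> carrier T" for x
    using g that by blast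
  fix x y assume xy: "x \<in> carrier T" "y \<in> carrier T"
  have "f (?g x \<cdot>\<^bsub>S\<^esub> ?g y) = x \<cdot>\<^bsub>T\<^esub> y"
    using xy g by (simp add: sgrp_homD(2)[OF f(1)])
  then show "?g (x \<cdot>\<^bsub>T\<^esub> y) = ?g x \<cdot>\<^bsub>S\<^esub> ?g y"
    using f(2) g xy is_semigroupD(1)[OF S] by (metis bij_betw_inv_into_left)
qed

lemma sgrp_prod_is_semigroup:
  assumes "\<And>i. i < n \<Longrightarrow> is_semigroup (S i)"
  shows "is_semigroup (sgrp_prod n S)"
proof -
  have ne: "(\<Pi>\<^sub>E i\<in>{..<n}. carrier (S i)) \<noteq> {}"
    using is_semigroupD(3)[OF assms] by (simp add: PiE_eq_empty_iff)
  show ?thesis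
    unfolding is_semigroup_def sgrp_prod_def
    using ne is_semigroupD(1,2)[OF assms]
    by (auto simp: PiE_iff intro!: restrict_ext)
qed

section \<open>Closure properties of pseudovarieties up to isomorphism\<close>

lemma pseudovariety_finite_semigroups: "pseudovariety finite_semigroups"
proof -
  have "contains_copy finite_semigroups (sgrp_prod n S)"
    if "\<forall>i<n. S i \<in> finite_semigroups" for n and S :: "nat \<Rightarrow> nat sgrp"
  proof (rule finite_semigroup_has_copy)
    show "is_semigroup (sgrp_prod n S)"
      using that by (auto simp: finite_semigroups_def intro: sgrp_prod_is_semigroup)
    show "finite (carrier (sgrp_prod n S))"
      using that by (auto simp: finite_semigroups_def sgrp_prod_def intro: finite_PiE)
  qed
  moreover have "\<lparr>carrier = H, mult = mult S\<rparr> \<in> finite_semigroups"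
    if "S \<in> finite_semigroups" "is_subsemigroup H S" for H and S :: "nat sgrp"
    using that finite_subset[of H "carrier S"]
    by (auto simp: finite_semigroups_def is_subsemigroup_def is_semigroup_def subset_iff)
  ultimately show ?thesis
    by (auto simp: pseudovariety_def)
qed

text \<open>An isomorphism is in particular a surjective homomorphism, so closure under homomorphic
  images turns a copy in \<open>C\<close> into membership.\<close>

lemma contains_copy_self:
  assumes C: "pseudovariety C" and T: "T \<in> finite_semigroups" "contains_copy C T"
  shows "T \<in> C"
proof -
  obtain S f where "S \<in> C" "f \<in> sgrp_hom S T" "f ` carrier S = carrier T"
    using T(2) by (auto simp: contains_copy_def sgrp_iso_def bij_betw_def)
  moreover from C have "\<forall>S\<in>C. \<forall>T\<in>finite_semigroups. \<forall>f\<in>sgrp_hom S T.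
      f ` carrier S = carrier T \<longrightarrow> T \<in> C"
    unfolding pseudovariety_def by (elim conjE)
  ultimately show ?thesis
    using T(1) by blast
qed

text \<open>Closure under subsemigroups for arbitrary carrier types: \<open>D\<close> is mapped
  through \<open>X\<close> into a representative \<open>P\<close> in \<open>C\<close>, and its image
  there is a subsemigroup of \<open>P\<close> isomorphic to \<open>D\<close>.\<close>

lemma contains_copy_embed:
  assumes C: "pseudovariety C" "contains_copy C X" and D: "is_semigroup D"
    and f: "f \<in> sgrp_hom D X" "inj_on f (carrier D)"
  shows "contains_copy C D"
proof -
  obtain P \<phi> where P: "P \<in> C" and \<phi>: "\<phi> \<in> sgrp_hom P X" "bij_betw \<phi> (carrier P) (carrier X)"
    using C(2) by (auto simp: contains_copy_def sgrp_iso_def)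
  have sP: "is_semigroup P"
    using C(1) P by (auto simp: pseudovariety_def finite_semigroups_def)
  define g where "g = inv_into (carrier P) \<phi> \<circ> f"
  define H where "H = g ` carrier D"
  have g: "g \<in> sgrp_hom D P"
    unfolding g_def by (rule sgrp_hom_comp[OF f(1) sgrp_hom_inv_into[OF sP \<phi>]])
  have "inj_on (inv_into (carrier P) \<phi>) (f ` carrier D)"
    using \<phi>(2) sgrp_homD(1)[OF f(1)]
    by (intro inj_on_subset[OF bij_betw_imp_inj_on[OF bij_betw_inv_into]]) auto
  then have inj: "inj_on g (carrier D)"
    unfolding g_def by (rule comp_inj_on[OF f(2)])
  have gH: "g \<in> sgrp_hom D \<lparr>carrier = H, mult = mult P\<rparr>"
    "bij_betw g (carrier D) (carrier \<lparr>carrier = H, mult = mult P\<rparr>)"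
    using g inj by (auto simp: sgrp_hom_def H_def bij_betw_def)
  have "is_subsemigroup H P"
    unfolding is_subsemigroup_def H_def
    using is_semigroupD(1,3)[OF D] sgrp_homD[OF g] by (auto simp flip: sgrp_homD(2)[OF g])
  then have "\<lparr>carrier = H, mult = mult P\<rparr> \<in> C"
    using C(1) P by (auto simp: pseudovariety_def)
  then show ?thesis
    unfolding contains_copy_def sgrp_iso_def
    using sgrp_hom_inv_into[OF D gH] bij_betw_inv_into[OF gH(2)] by blast
qed

text \<open>The product clause of a pseudovariety speaks only of members of \<open>C\<close>. A
  power of \<open>X\<close> is therefore embedded into the same power of a representative
  \<open>P\<close>.\<close>

lemma contains_copy_power:
  assumes C: "pseudovariety C" "contains_copy C X"
  shows "contains_copy C (sgrp_prod n (\<lambda>_. X))"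
proof -
  obtain P \<phi> where P: "P \<in> C" and \<phi>: "\<phi> \<in> sgrp_hom P X" "bij_betw \<phi> (carrier P) (carrier X)"
    using C(2) by (auto simp: contains_copy_def sgrp_iso_def)
  have sP: "is_semigroup P"
    using C(1) P by (auto simp: pseudovariety_def finite_semigroups_def)
  define \<psi> where "\<psi> = inv_into (carrier P) \<phi>"
  have \<psi>: "\<psi> \<in> sgrp_hom X P" "inj_on \<psi> (carrier X)"
    using sgrp_hom_inv_into[OF sP \<phi>] bij_betw_inv_into[OF \<phi>(2)]
    by (auto simp: \<psi>_def bij_betw_def)
  \<comment> \<open>The semigroup laws pass from \<open>P\<close> to its homomorphic image
    \<open>X\<close>.\<close>
  have X: "is_semigroup X"
    unfolding is_semigroup_def
  proof (intro conjI ballI)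
    have X: "carrier X = \<phi> ` carrier P" using \<phi>(2) by (simp add: bij_betw_def)
    note h = sgrp_homD(2)[OF \<phi>(1), symmetric]
    show "carrier X \<noteq> {}" using X is_semigroupD(3)[OF sP] by simp
    show "x \<cdot>\<^bsub>X\<^esub> y \<in> carrier X" if "x \<in> carrier X" "y \<in> carrier X" for x y
      using that is_semigroupD(1)[OF sP] by (auto simp: X h)
    show "(x \<cdot>\<^bsub>X\<^esub> y) \<cdot>\<^bsub>X\<^esub> z = x \<cdot>\<^bsub>X\<^esub> (y \<cdot>\<^bsub>X\<^esub> z)"
      if "x \<in> carrier X" "y \<in> carrier X" "z \<in> carrier X" for x y z
      using that is_semigroupD(1,2)[OF sP] by (auto simp: X h)
  qed
  \<comment> \<open>The coordinatewise embedding; restricting to \<open>{..<n}\<close> keeps the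
    values extensional, as \<open>\<Pi>\<^sub>E\<close> demands.\<close>
  define F where "F x = (\<lambda>i\<in>{..<n}. \<psi> (x i))" for x :: "nat \<Rightarrow> _"
  have "F \<in> sgrp_hom (sgrp_prod n (\<lambda>_. X)) (sgrp_prod n (\<lambda>_. P))"
    using sgrp_homD[OF \<psi>(1)]
    by (intro sgrp_homI) (auto simp: F_def sgrp_prod_def PiE_iff intro!: restrict_ext)
  moreover have "inj_on F (carrier (sgrp_prod n (\<lambda>_. X)))"
  proof (rule inj_onI)
    fix x y assume x: "x \<in> carrier (sgrp_prod n (\<lambda>_. X))"
      and y: "y \<in> carrier (sgrp_prod n (\<lambda>_. X))" and eq: "F x = F y"
    show "x = y"
    proof (rule PiE_ext)
      show "x \<in> (\<Pi>\<^sub>E i\<in>{..<n}. carrier X)" "y \<in> (\<Pi>\<^sub>E i\<in>{..<n}. carrier X)"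
        using x y by (simp_all add: sgrp_prod_def)
      then show "x i = y i" if "i \<in> {..<n}" for i
        using that fun_cong[OF eq, of i] \<psi>(2) by (auto simp: F_def PiE_iff inj_on_def)
    qed
  qed
  moreover have "contains_copy C (sgrp_prod n (\<lambda>_. P))"
    using C(1) P by (simp add: pseudovariety_def)
  ultimately show ?thesis
    using contains_copy_embed[OF C(1)] sgrp_prod_is_semigroup[of n "\<lambda>_. X"] X by blast
qed

text \<open>Being F-epimorphically closed is a condition on semigroups over the naturals, so the
  epimorphism is conjugated by isomorphisms from \<open>P\<close> to \<open>S\<close> and from
  \<open>T\<close> to a numbered copy \<open>Q\<close>.\<close>

lemma contains_copy_epimorphism:
  assumes C: "pseudovariety C" "F_epimorphically_closed C" "contains_copy C S"
    and \<alpha>: "epimorphism S T \<alpha>" and T: "finite (carrier T)"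
  shows "contains_copy C T"
proof -
  obtain P \<phi> where P: "P \<in> C" and \<phi>: "\<phi> \<in> sgrp_hom P S" "bij_betw \<phi> (carrier P) (carrier S)"
    using C(3) by (auto simp: contains_copy_def sgrp_iso_def)
  have sP: "is_semigroup P"
    using C(1) P by (auto simp: pseudovariety_def finite_semigroups_def)
  have sT: "is_semigroup T" and hom: "\<alpha> \<in> sgrp_hom S T"
    using \<alpha> by (auto simp: epimorphism_def)
  obtain Q h where Q: "Q \<in> finite_semigroups"
    and h: "h \<in> sgrp_hom Q T" "bij_betw h (carrier Q) (carrier T)"
    using finite_semigroup_has_copy[OF sT T] by (auto simp: contains_copy_def sgrp_iso_def)
  have sQ: "is_semigroup Q"
    using Q by (simp add: finite_semigroups_def)
  define k where "k = inv_into (carrier Q) h"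
  have k: "k \<in> sgrp_hom T Q" "bij_betw k (carrier T) (carrier Q)"
    unfolding k_def by (rule sgrp_hom_inv_into[OF sQ h], rule bij_betw_inv_into[OF h(2)])
  have "epimorphism P Q (k \<circ> \<alpha> \<circ> \<phi>)"
    unfolding epimorphism_def
  proof (intro conjI allI impI)
    show "k \<circ> \<alpha> \<circ> \<phi> \<in> sgrp_hom P Q"
      by (intro sgrp_hom_comp[of _ P S] sgrp_hom_comp[of _ S T] \<phi> hom k)
    fix R :: "nat sgrp" assume R: "is_semigroup R"
    show "\<forall>\<beta>\<in>sgrp_hom Q R. \<forall>\<gamma>\<in>sgrp_hom Q R.
        (\<forall>x\<in>carrier P. \<beta> ((k \<circ> \<alpha> \<circ> \<phi>) x) = \<gamma> ((k \<circ> \<alpha> \<circ> \<phi>) x)) \<longrightarrow>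
        (\<forall>y\<in>carrier Q. \<beta> y = \<gamma> y)"
    proof (intro ballI impI)
      fix \<beta> \<gamma> y assume bc: "\<beta> \<in> sgrp_hom Q R" "\<gamma> \<in> sgrp_hom Q R"
        and eq: "\<forall>x\<in>carrier P. \<beta> ((k \<circ> \<alpha> \<circ> \<phi>) x) = \<gamma> ((k \<circ> \<alpha> \<circ> \<phi>) x)"
        and y: "y \<in> carrier Q"
      \<comment> \<open>As \<phi> maps onto \<open>S\<close>, agreement over \<open>P\<close>
        becomes agreement over \<open>S\<close>, and \<alpha> can be cancelled from the
        homomorphisms composed with \<open>k\<close>.\<close>
      have "\<forall>x\<in>carrier S. (\<beta> \<circ> k) (\<alpha> x) = (\<gamma> \<circ> k) (\<alpha> x)"
        using eq by (simp flip: bij_betw_imp_surj_on[OF \<phi>(2)])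
      then have "\<forall>t\<in>carrier T. (\<beta> \<circ> k) t = (\<gamma> \<circ> k) t"
        using \<alpha> R sgrp_hom_comp[OF k(1) bc(1)] sgrp_hom_comp[OF k(1) bc(2)]
        unfolding epimorphism_def by blast
      then show "\<beta> y = \<gamma> y"
        using y by (auto simp flip: bij_betw_imp_surj_on[OF k(2)])
    qed
  qed (rule sP, rule sQ)
  then have "Q \<in> C"
    using C(2) P Q unfolding F_epimorphically_closed_def by blast
  then show ?thesis
    using h by (auto simp: contains_copy_def sgrp_iso_def)
qed

section \<open>Weak inverses, matrix semigroups and adjoined identities\<close>

text \<open>A zigzag argument: the factor \<open>ts\<close> lets \<beta> be exchanged for \<gamma>
  on the left of \<open>tst = t\<close>, then \<open>s\<close> changes back to \<beta>, and
  \<open>st\<close> carries the exchange to the right end.\<close>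

lemma hom_agree_on_weak_inverse:
  assumes R: "is_semigroup R" and \<beta>: "\<beta> \<in> sgrp_hom T R" and \<gamma>: "\<gamma> \<in> sgrp_hom T R"
    and T: "is_semigroup T" "s \<in> carrier T" "t \<in> carrier T" "t \<cdot>\<^bsub>T\<^esub> s \<cdot>\<^bsub>T\<^esub> t = t"
    and eq: "\<beta> s = \<gamma> s" "\<beta> (s \<cdot>\<^bsub>T\<^esub> t) = \<gamma> (s \<cdot>\<^bsub>T\<^esub> t)" "\<beta> (t \<cdot>\<^bsub>T\<^esub> s) = \<gamma> (t \<cdot>\<^bsub>T\<^esub> s)"
  shows "\<beta> t = \<gamma> t"
proof -
  note c = is_semigroupD(1)[OF T(1)] T(2,3)
  have "\<beta> t = \<beta> (t \<cdot>\<^bsub>T\<^esub> s) \<cdot>\<^bsub>R\<^esub> \<beta> t"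
    using T c by (simp flip: sgrp_homD(2)[OF \<beta>])
  also have "\<dots> = (\<gamma> t \<cdot>\<^bsub>R\<^esub> \<gamma> s) \<cdot>\<^bsub>R\<^esub> \<beta> t"
    using c eq(3) by (simp add: sgrp_homD(2)[OF \<gamma>])
  also have "\<dots> = \<gamma> t \<cdot>\<^bsub>R\<^esub> \<beta> (s \<cdot>\<^bsub>T\<^esub> t)"
    using c by (simp add: sgrp_homD[OF \<beta>] sgrp_homD(1)[OF \<gamma>] is_semigroupD(2)[OF R] flip: eq(1))
  also have "\<dots> = \<gamma> (t \<cdot>\<^bsub>T\<^esub> s \<cdot>\<^bsub>T\<^esub> t)"
    using c eq(2) by (simp add: sgrp_homD(2)[OF \<gamma>] is_semigroupD(2)[OF T(1)])
  finally show ?thesis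
    using T(4) by simp
qed

text \<open>\<open>Some (i, x, j)\<close> is the matrix with entry \<open>x\<close> at \<open>(i, j)\<close>, where \<open>False\<close> is the first and
  \<open>True\<close> the second index.\<close>

fun unit_mult :: "'m sgrp \<Rightarrow> (bool \<times> 'm \<times> bool) option \<Rightarrow> (bool \<times> 'm \<times> bool) option
    \<Rightarrow> (bool \<times> 'm \<times> bool) option" where
  "unit_mult M (Some (i, x, j)) (Some (k, y, l)) = (if j = k then Some (i, x \<cdot>\<^bsub>M\<^esub> y, l) else None)"
| "unit_mult M _ _ = None"

text \<open>For a monoid \<open>M\<close> this is the Rees matrix semigroup with zero
  \<open>None\<close> and the 2 by 2 identity as sandwich matrix. A one-element \<open>M\<close>
  gives \<open>B2\<close>.\<close>

definition brandt :: "'m sgrp \<Rightarrow> (bool \<times> 'm \<times> bool) option sgrp" where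
  "brandt M = \<lparr>carrier = insert None (Some ` (UNIV \<times> carrier M \<times> UNIV)), mult = unit_mult M\<rparr>"

text \<open>Here \<open>u\<close> stands for the identity of \<open>M\<close>. A one-element
  \<open>M\<close> gives \<open>Y\<close>, with \<open>u\<close> at (1,1), (1,2), (2,2) in the roles
  of \<open>AB\<close>, \<open>A\<close>, \<open>BA\<close>.\<close>

definition triangular :: "'m sgrp \<Rightarrow> 'm \<Rightarrow> (bool \<times> 'm \<times> bool) option sgrp" where
  "triangular M u = \<lparr>carrier = {None, Some (False, u, False), Some (True, u, True)}
     \<union> (\<lambda>m. Some (False, m, True)) ` carrier M, mult = unit_mult M\<rparr>"

text \<open>The identity \<open>None\<close> is new even if \<open>S\<close> already has one, so
  \<open>Some\<close> is always an embedding of \<open>S\<close>.\<close>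

definition adjoin_one :: "'a sgrp \<Rightarrow> 'a option sgrp" where
  "adjoin_one S = \<lparr>carrier = insert None (Some ` carrier S),
     mult = (\<lambda>x y. case x of None \<Rightarrow> y | Some a \<Rightarrow>
       (case y of None \<Rightarrow> x | Some b \<Rightarrow> Some (a \<cdot>\<^bsub>S\<^esub> b)))\<rparr>"

lemma adjoin_one_is_semigroup:
  assumes "is_semigroup S"
  shows "is_semigroup (adjoin_one S)"
  using is_semigroupD(3)[OF assms]
  by (auto simp: is_semigroup_def adjoin_one_def is_semigroupD(1,2)[OF assms])

lemma brandt_is_semigroup:
  assumes "is_semigroup M"
  shows "is_semigroup (brandt M)"
  using is_semigroupD(3)[OF assms]
  by (auto simp: is_semigroup_def brandt_def is_semigroupD(1,2)[OF assms])

section \<open>Triangular matrices over a monoid: epimorphism and embedding into a power of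
  \<open>Y\<close>\<close>

locale sgrp_monoid =
  fixes M :: "'m sgrp" and u :: 'm
  assumes sgrp: "is_semigroup M" and u: "u \<in> carrier M"
    and unit: "x \<in> carrier M \<Longrightarrow> u \<cdot>\<^bsub>M\<^esub> x = x" "x \<in> carrier M \<Longrightarrow> x \<cdot>\<^bsub>M\<^esub> u = x"
begin

lemma triangular_subset_brandt: "carrier (triangular M u) \<subseteq> carrier (brandt M)"
  using u by (auto simp: triangular_def brandt_def)

lemma triangular_is_semigroup: "is_semigroup (triangular M u)"
  unfolding is_semigroup_def
proof (intro conjI ballI)
  show "carrier (triangular M u) \<noteq> {}"
    by (simp add: triangular_def)
  show "x \<cdot>\<^bsub>triangular M u\<^esub> y \<in> carrier (triangular M u)"
    if "x \<in> carrier (triangular M u)" "y \<in> carrier (triangular M u)" for x y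
    using that by (auto simp: triangular_def u unit)
  show "(x \<cdot>\<^bsub>triangular M u\<^esub> y) \<cdot>\<^bsub>triangular M u\<^esub> z = x \<cdot>\<^bsub>triangular M u\<^esub> (y \<cdot>\<^bsub>triangular M u\<^esub> z)"
    if "x \<in> carrier (triangular M u)" "y \<in> carrier (triangular M u)" "z \<in> carrier (triangular M u)"
    for x y z
    \<comment> \<open>Associativity is inherited from \<open>brandt M\<close>, which has the same
      multiplication.\<close>
    using is_semigroupD(2)[OF brandt_is_semigroup[OF sgrp]
        that[THEN subsetD[OF triangular_subset_brandt]]]
    by (simp add: triangular_def brandt_def)
qed

lemma triangular_epimorphism: "epimorphism (triangular M u) (brandt M) id"
  unfolding epimorphism_def
proof (intro conjI allI impI)
  show "id \<in> sgrp_hom (triangular M u) (brandt M)"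
    using triangular_subset_brandt by (auto simp: sgrp_hom_def triangular_def brandt_def)
  fix R :: "nat sgrp" assume R: "is_semigroup R"
  show "\<forall>\<beta>\<in>sgrp_hom (brandt M) R. \<forall>\<gamma>\<in>sgrp_hom (brandt M) R.
      (\<forall>x\<in>carrier (triangular M u). \<beta> (id x) = \<gamma> (id x)) \<longrightarrow> (\<forall>y\<in>carrier (brandt M). \<beta> y = \<gamma> y)"
  proof (intro ballI impI)
    fix \<beta> \<gamma> y assume \<beta>: "\<beta> \<in> sgrp_hom (brandt M) R" and \<gamma>: "\<gamma> \<in> sgrp_hom (brandt M) R"
      and "\<forall>x\<in>carrier (triangular M u). \<beta> (id x) = \<gamma> (id x)" and y: "y \<in> carrier (brandt M)"
    then have eq: "\<beta> None = \<gamma> None" "\<beta> (Some (False, u, False)) = \<gamma> (Some (False, u, False))"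
      "\<beta> (Some (True, u, True)) = \<gamma> (Some (True, u, True))"
      "\<And>m. m \<in> carrier M \<Longrightarrow> \<beta> (Some (False, m, True)) = \<gamma> (Some (False, m, True))"
      by (auto simp: triangular_def)
    \<comment> \<open>The matrix unit at (2,1). Its products with the one at (1,2), in either order,
      are the diagonal idempotents, on which \<beta> and \<gamma> already agree.\<close>
    let ?b = "Some (True, u, False)"
    have b: "\<beta> ?b = \<gamma> ?b"
      by (rule hom_agree_on_weak_inverse[OF R \<beta> \<gamma> brandt_is_semigroup[OF sgrp],
            of "Some (False, u, True)"])
        (use u unit eq in \<open>auto simp: brandt_def\<close>)
    have mult: "\<beta> (unit_mult M v w) = \<gamma> (unit_mult M v w)"
      if "\<beta> v = \<gamma> v" "\<beta> w = \<gamma> w" "v \<in> carrier (brandt M)" "w \<in> carrier (brandt M)" for v w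
      using that sgrp_homD(2)[OF \<beta>, of v w] sgrp_homD(2)[OF \<gamma>, of v w] by (simp add: brandt_def)
    have c: "Some (i, m, j) \<in> carrier (brandt M)" if "m \<in> carrier M" for i m j
      using that by (auto simp: brandt_def)
    \<comment> \<open>Entry \<open>m\<close> at (1,1) arises from \<open>m\<close> at (1,2) by
      multiplying by \<open>?b\<close> on the right.\<close>
    have 11: "\<beta> (Some (False, m, False)) = \<gamma> (Some (False, m, False))" if "m \<in> carrier M" for m
      using mult[OF eq(4) b] that u unit c by simp
    \<comment> \<open>Left multiplication by \<open>?b\<close> moves an entry from the first row to
      the second.\<close>
    have 2: "\<beta> (Some (True, m, j)) = \<gamma> (Some (True, m, j))" if "m \<in> carrier M" for m j
      using mult[OF b 11[of m]] mult[OF b eq(4)[of m]] that u unit c by (cases j) auto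
    show "\<beta> y = \<gamma> y"
    proof (cases y)
      case (Some p)
      then obtain i m j where p: "y = Some (i, m, j)" "m \<in> carrier M"
        using y by (auto simp: brandt_def)
      then show ?thesis
        using eq(4) 11 2 by (cases i; cases j) auto
    qed (simp add: eq(1))
  qed
qed (rule triangular_is_semigroup, rule brandt_is_semigroup[OF sgrp])

text \<open>Two (1,2) entries always multiply to zero, so each of them may be sent to
  \<open>A\<close> or \<open>Zero\<close> independently. One coordinate per element of
  \<open>M\<close> then suffices to separate them.\<close>

lemma triangular_embeds_in_power:
  assumes fin: "finite (carrier M)"
  shows "\<exists>n. \<exists>F \<in> sgrp_hom (triangular M u) (sgrp_prod n (\<lambda>_. Y)). inj_on F (carrier (triangular M u))"
proof -
  obtain n and h :: "'m \<Rightarrow> nat" where h: "h ` carrier M = {i. i < n}" "inj_on h (carrier M)"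
    using finite_imp_inj_to_nat_seg[OF fin] by blast
  \<comment> \<open>Coordinate \<open>i\<close> sends only the (1,2) entry numbered \<open>i\<close>
    to \<open>A\<close>. The diagonal idempotents go to \<open>AB\<close> and \<open>BA\<close> in
    every coordinate.\<close>
  define f where "f i x = (case x of None \<Rightarrow> Zero | Some (j, m, k) \<Rightarrow>
      if \<not> k then AB else if j then BA else if h m = i then A else Zero)" for i x
  define F where "F x = (\<lambda>i\<in>{..<n}. f i x)" for x
  have fY: "f i x \<in> carrier Y" for i x
    by (auto simp: f_def Y_def split: option.split)
  have f_mult: "f i (unit_mult M x y) = b2_mult (f i x) (f i y)"
    if "x \<in> carrier (triangular M u)" "y \<in> carrier (triangular M u)" for i x y
    using that by (auto simp: f_def triangular_def u unit)
  have "F \<in> sgrp_hom (triangular M u) (sgrp_prod n (\<lambda>_. Y))"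
  proof (rule sgrp_homI)
    show "F x \<in> carrier (sgrp_prod n (\<lambda>_. Y))" if "x \<in> carrier (triangular M u)" for x
      using fY by (simp add: F_def sgrp_prod_def)
    show "F (x \<cdot>\<^bsub>triangular M u\<^esub> y) = F x \<cdot>\<^bsub>sgrp_prod n (\<lambda>_. Y)\<^esub> F y"
      if "x \<in> carrier (triangular M u)" "y \<in> carrier (triangular M u)" for x y
      using f_mult[OF that]
      by (auto simp: F_def sgrp_prod_def triangular_def Y_def intro!: restrict_ext)
  qed
  moreover have "inj_on F (carrier (triangular M u))"
  proof (rule inj_onI)
    fix x y assume x: "x \<in> carrier (triangular M u)" and y: "y \<in> carrier (triangular M u)"
      and Fxy: "F x = F y"
    have eq: "f (h m) x = f (h m) y" if "m \<in> carrier M" for m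
    proof -
      have "h m < n" using that h(1) by blast
      then show ?thesis using fun_cong[OF Fxy, of "h m"] by (simp add: F_def)
    qed
    \<comment> \<open>Coordinate \<open>h m\<close> takes the value \<open>A\<close> at exactly one
      triangular matrix, so it detects the entry \<open>m\<close> at (1,2).\<close>
    have A_iff: "f (h m) x = A \<longleftrightarrow> x = Some (False, m, True)"
      if "x \<in> carrier (triangular M u)" "m \<in> carrier M" for x m
      using that by (auto simp: f_def triangular_def inj_on_eq_iff[OF h(2)] split: if_splits)
    show "x = y"
    proof (cases "\<exists>m\<in>carrier M. x = Some (False, m, True) \<or> y = Some (False, m, True)")
      case True
      then obtain m where "m \<in> carrier M" "x = Some (False, m, True) \<or> y = Some (False, m, True)"
        by blast
      moreover from this have "x = Some (False, m, True) \<longleftrightarrow> y = Some (False, m, True)"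
        using A_iff[OF x, of m] A_iff[OF y, of m] eq[of m] by simp
      ultimately show ?thesis by metis
    next
      case False
      have "z = None \<or> z = Some (False, u, False) \<or> z = Some (True, u, True)"
        if "z \<in> carrier (triangular M u)" "\<forall>m\<in>carrier M. z \<noteq> Some (False, m, True)" for z
        using that by (auto simp: triangular_def)
      then have "x = None \<or> x = Some (False, u, False) \<or> x = Some (True, u, True)"
        and "y = None \<or> y = Some (False, u, False) \<or> y = Some (True, u, True)"
        using x y False by blast+
      \<comment> \<open>The three remaining elements have the distinct values \<open>Zero\<close>,
        \<open>AB\<close>, \<open>BA\<close> in every coordinate; \<open>u\<close> ensures that
        there is one.\<close>
      then show ?thesis
        using eq[OF u] by (elim disjE) (simp_all add: f_def)
    qed
  qed
  ultimately show ?thesis by blast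
qed

lemma contains_copy_of_monoid:
  assumes C: "pseudovariety C" "F_epimorphically_closed C" "contains_copy C Y"
    and fin: "finite (carrier M)"
  shows "contains_copy C M"
proof -
  have "contains_copy C (triangular M u)"
    using triangular_embeds_in_power[OF fin] contains_copy_embed[OF C(1)]
      contains_copy_power[OF C(1,3)] triangular_is_semigroup by blast
  then have "contains_copy C (brandt M)"
    by (rule contains_copy_epimorphism[OF C(1,2) _ triangular_epimorphism])
      (use fin in \<open>simp add: brandt_def\<close>)
  then show ?thesis
    by (rule contains_copy_embed[OF C(1) _ sgrp, where f = "\<lambda>m. Some (False, m, False)"])
      (auto simp: sgrp_hom_def brandt_def inj_on_def)
qed

end

section \<open>Reaching an arbitrary finite semigroup through its monoid extension\<close>

theorem theorem5p4:
  shows "pseudovariety finite_semigroups \<and> F_epimorphically_closed finite_semigroups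
      \<and> contains_copy finite_semigroups Y
      \<and> (\<forall>C. pseudovariety C \<and> F_epimorphically_closed C \<and> contains_copy C Y
            \<longrightarrow> finite_semigroups \<subseteq> C)"
proof (intro conjI allI impI subsetI)
  show "pseudovariety finite_semigroups" by (rule pseudovariety_finite_semigroups)
  \<comment> \<open>Immediate, since the targets in the closure condition range over finite
    semigroups only.\<close>
  show "F_epimorphically_closed finite_semigroups" by (simp add: F_epimorphically_closed_def)
  have "is_semigroup Y"
    using B2_is_semigroup Y_subsemigroup(1)
    by (auto simp: is_semigroup_def is_subsemigroup_def B2_def Y_def)
  then show "contains_copy finite_semigroups Y"
    by (rule finite_semigroup_has_copy) (simp add: Y_def)
  fix C and S :: "nat sgrp"
  assume C: "pseudovariety C \<and> F_epimorphically_closed C \<and> contains_copy C Y"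
    and fin: "S \<in> finite_semigroups"
  then have S: "is_semigroup S" "finite (carrier S)"
    by (auto simp: finite_semigroups_def)
  interpret sgrp_monoid "adjoin_one S" None
    by unfold_locales (use adjoin_one_is_semigroup[OF S(1)] in
        \<open>auto simp: adjoin_one_def split: option.splits\<close>)
  have "contains_copy C (adjoin_one S)"
    using C S(2) by (intro contains_copy_of_monoid) (auto simp: adjoin_one_def)
  then have "contains_copy C S"
    using C S(1) by (intro contains_copy_embed[of C "adjoin_one S" S Some])
      (auto simp: sgrp_hom_def adjoin_one_def)
  \<comment> \<open>\<open>S\<close> itself has its carrier in the naturals, so a copy of it in
    \<open>C\<close> puts \<open>S\<close> into \<open>C\<close>.\<close>
  then show "S \<in> C"
    using C fin contains_copy_self by blast
qed

end
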